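(* Let $\alpha,\beta\in\mathbb{R}$ with $\alpha^2+\beta^2=1$ be such that the four numbers $1,\ \alpha^2-\beta^2,\ 2\alpha\beta,\ 0$ are pairwise distinct. Let $|0\rangle,|1\rangle$ be the standard orthonormal basis of $\mathbb{C}^2$ and put $$|\phi_d\rangle=\alpha|0\rangle+\beta|1\rangle,\qquad |\phi_a^1\rangle=\alpha|0\rangle+\beta|1\rangle,\quad |\phi_a^2\rangle=\alpha|1\rangle+\beta|0\rangle,\quad |\phi_a^3\rangle=\alpha|0\rangle-\beta|1\rangle,\quad |\phi_a^4\rangle=\alpha|1\rangle-\beta|0\rangle .$$ Let $D$ be a (hypothetical, not necessarily quantum-mechanical) device which assigns to each pure qubit state a probability distribution of its output, and suppose that on input $|\phi_a^i\rangle$ it outputs $\langle\phi_a^i|\phi_d\rangle$ with probability $1$, for each $i=1,2,3,4$. Suppose Alice (first qubit) and Bob (second qubit) share the singlet state $|\Psi^-\rangle=\frac{1}{\sqrt2}(|0\rangle|1\rangle-|1\rangle|0\rangle)$, Bob measures his qubit either in the orthonormal basis $M_1=\{|\phi_a^1\rangle,|\phi_a^4\rangle\}$ or in the orthonormal basis $M_2=\{|\phi_a^2\rangle,|\phi_a^3\rangle\}$, disclosing neither his choice nor his outcome, and Alice then applies $D$ to her qubit. Then Alice's output determines Bob's choice of basis with certainty, without any communication from Bob: there are disjoint sets $S_1,S_2\subset\mathbb{R}$ such that Alice's output lies in $S_1$ with probability $1$ if Bob measures in $M_1$ and lies in $S_2$ with probability $1$ if Bob measures in $M_2$. In particular, the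 no-signalling principle is violated.
   Context: Pure qubit states are unit vectors in $\mathbb{C}^2$ up to a global phase; the device $D$ is a map from such states (up to phase) to probability distributions on $\mathbb{R}$, and no further property (such as linearity in the density matrix) is assumed. The values required of $D$ are $\langle\phi_a^1|\phi_d\rangle=1$, $\langle\phi_a^2|\phi_d\rangle=2\alpha\beta$, $\langle\phi_a^3|\phi_d\rangle=\alpha^2-\beta^2$, $\langle\phi_a^4|\phi_d\rangle=0$. When Bob measures the second qubit of $|\Psi\rangle\in\mathbb{C}^2\otimes\mathbb{C}^2$ in an orthonormal basis $\{|e_1\rangle,|e_2\rangle\}$, he obtains outcome $k$ with probability $\|(I\otimes\langle e_k|)|\Psi\rangle\|^2$, and Alice's qubit is then in the normalized state proportional to $(I\otimes\langle e_k|)|\Psi\rangle$. The distribution of Alice's output for a given choice of Bob's basis is the mixture, over Bob's outcomes weighted by their probabilities, of the output distributions of $D$ on the corresponding states of Alice's qubit. The no-signalling principle states that the distribution of Alice's output does not depend on Bob's choice of measurement basis. *)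

theory Defs
  imports "HOL-Probability.Probability"
begin

definition ket0 :: "complex ^ 2" where "ket0 = axis 1 1"

definition ket1 :: "complex ^ 2" where "ket1 = axis 2 1"

text \<open>The library inner product on \<open>complex ^ 'n\<close> is the real-valued one (the real part of this).\<close>

definition braket :: "complex ^ 'n \<Rightarrow> complex ^ 'n \<Rightarrow> complex" where
  "braket u v = (\<Sum>i\<in>UNIV. cnj (u $ i) * v $ i)"

text \<open>The space \<open>\<complex>\<^sup>2 \<otimes> \<complex>\<^sup>2\<close> is \<open>complex ^ (2 \<times> 2)\<close>: the coordinate \<open>(i, j)\<close> belongs to the
  product of the \<open>i\<close>-th basis vector of the first qubit and the \<open>j\<close>-th of the second.\<close>

definition tensor :: "complex ^ 2 \<Rightarrow> complex ^ 2 \<Rightarrow> complex ^ (2 \<times> 2)" where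
  "tensor u v = (\<chi> p. u $ fst p * v $ snd p)"

definition singlet :: "complex ^ (2 \<times> 2)" where
  "singlet = complex_of_real (1 / sqrt 2) *s (tensor ket0 ket1 - tensor ket1 ket0)"

text \<open>\<open>partial_bra e \<Psi>\<close> is \<open>(I \<otimes> \<langle>e|) |\<Psi>\<rangle>\<close>.\<close>

definition partial_bra :: "complex ^ 2 \<Rightarrow> complex ^ (2 \<times> 2) \<Rightarrow> complex ^ 2" where
  "partial_bra e \<Psi> = (\<chi> i. \<Sum>j\<in>UNIV. cnj (e $ j) * \<Psi> $ (i, j))"

definition outcome_prob :: "complex ^ (2 \<times> 2) \<Rightarrow> complex ^ 2 \<Rightarrow> real" where
  "outcome_prob \<Psi> e = (norm (partial_bra e \<Psi>))\<^sup>2"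

definition post_state :: "complex ^ (2 \<times> 2) \<Rightarrow> complex ^ 2 \<Rightarrow> complex ^ 2" where
  "post_state \<Psi> e = partial_bra e \<Psi> /\<^sub>R norm (partial_bra e \<Psi>)"

definition orthonormal_basis :: "(complex ^ 2) set \<Rightarrow> bool" where
  "orthonormal_basis B \<longleftrightarrow>
     (\<forall>u\<in>B. \<forall>v\<in>B. braket u v = (if u = v then 1 else 0)) \<and> vec.span B = UNIV"

text \<open>A map on pure states is a map on unit vectors that does not see the global phase; its values
  at vectors that are not of norm 1 are irrelevant.\<close>

definition device :: "(complex ^ 2 \<Rightarrow> real measure) \<Rightarrow> bool" where
  "device D \<longleftrightarrow>
     (\<forall>\<phi>. norm \<phi> = 1 \<longrightarrow> prob_space (D \<phi>) \<and> sets (D \<phi>) = sets borel) \<and>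
     (\<forall>\<phi> c. norm \<phi> = 1 \<longrightarrow> cmod c = 1 \<longrightarrow> D (c *s \<phi>) = D \<phi>)"

text \<open>The mixture over Bob's outcomes. An outcome of probability 0 has no post-measurement state
  (\<open>post_state\<close> is then 0), but its term vanishes since \<open>0 * x = 0\<close> in \<open>ennreal\<close>.\<close>

definition alice_output ::
    "(complex ^ 2 \<Rightarrow> real measure) \<Rightarrow> complex ^ (2 \<times> 2) \<Rightarrow> (complex ^ 2) set \<Rightarrow> real measure" where
  "alice_output D \<Psi> B = measure_of UNIV (sets borel)
     (\<lambda>A. \<Sum>e\<in>B. ennreal (outcome_prob \<Psi> e) * emeasure (D (post_state \<Psi> e)) A)"

lemma emeasure_alice_output:
  assumes "device D" and A: "A \<in> sets borel"
  shows "emeasure (alice_output D \<Psi> B) A =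
    (\<Sum>e\<in>B. ennreal (outcome_prob \<Psi> e) * emeasure (D (post_state \<Psi> e)) A)"
proof -
  let ?m = "\<lambda>A. \<Sum>e\<in>B. ennreal (outcome_prob \<Psi> e) * emeasure (D (post_state \<Psi> e)) A"
  have sets: "sets (D (post_state \<Psi> e)) = sets borel" if "outcome_prob \<Psi> e \<noteq> 0" for e
    using that assms(1) by (auto simp: device_def outcome_prob_def post_state_def)
  have "countably_additive (sets (borel :: real measure)) ?m"
  proof (rule countably_additiveI)
    fix F :: "nat \<Rightarrow> real set"
    assume F: "range F \<subseteq> sets borel" "disjoint_family F"
    have "(\<Sum>i. ?m (F i)) =
        (\<Sum>e\<in>B. \<Sum>i. ennreal (outcome_prob \<Psi> e) * emeasure (D (post_state \<Psi> e)) (F i))"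
      by (rule suminf_sum) simp
    also have "\<dots> = ?m (\<Union>i. F i)"
    proof (rule sum.cong[OF refl])
      fix e
      show "(\<Sum>i. ennreal (outcome_prob \<Psi> e) * emeasure (D (post_state \<Psi> e)) (F i)) =
          ennreal (outcome_prob \<Psi> e) * emeasure (D (post_state \<Psi> e)) (\<Union>i. F i)"
        using F sets[of e] by (cases "outcome_prob \<Psi> e = 0") (simp_all add: suminf_emeasure)
    qed
    finally show "(\<Sum>i. ?m (F i)) = ?m (\<Union>i. F i)" .
  qed
  moreover have "positive (sets (borel :: real measure)) ?m"
    by (simp add: positive_def)
  moreover have "sigma_algebra UNIV (sets (borel :: real measure))"
    using sets.sigma_algebra_axioms[of "borel :: real measure"] by simp
  ultimately show ?thesis
    unfolding alice_output_def using A by (intro emeasure_measure_of_sigma)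
qed

definition no_signalling :: "(complex ^ 2 \<Rightarrow> real measure) \<Rightarrow> complex ^ (2 \<times> 2) \<Rightarrow> bool" where
  "no_signalling D \<Psi> \<longleftrightarrow>
     (\<forall>B B'. orthonormal_basis B \<longrightarrow> orthonormal_basis B' \<longrightarrow>
        alice_output D \<Psi> B = alice_output D \<Psi> B')"

end

(* On the singlet, Bob's outcome \<psi> = a|0> + b|1> leaves Alice with the state orthogonal to \<psi>,
   cnj b |0> - cnj a |1>, with probability 1/2.  So M1 leaves her, up to phase, with \<phi>_a^4 or
   \<phi>_a^1, where D outputs 0 or 1, and M2 with \<phi>_a^3 or \<phi>_a^2, where D outputs
   \<alpha>^2 - \<beta>^2 or 2 \<alpha> \<beta>. *)

theory Submission
  imports Defs
begin

lemma norm_power2_complex2: "(norm (x :: complex ^ 2))\<^sup>2 = (cmod (x $ 1))\<^sup>2 + (cmod (x $ 2))\<^sup>2"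
  by (simp add: norm_vec_def L2_set_def sum_2 del: real_sqrt_pow2_iff)

lemma braket_scale_right: "braket u (c *s v) = c * braket u v"
  by (simp add: braket_def algebra_simps sum_distrib_left)

lemma braket_zero_right: "braket u 0 = 0"
  by (simp add: braket_def)

lemma braket_commute: "braket v u = cnj (braket u v)"
  by (simp add: braket_def mult.commute)

text \<open>Orthogonality of nonzero vectors gives linear independence, and two independent vectors
  span by counting dimensions.\<close>

lemma orthonormal_basis_pair:
  assumes u: "braket u u = 1" and v: "braket v v = 1" and uv: "braket u v = 0"
  shows "orthonormal_basis {u, v}"
proof -
  have vu: "braket v u = 0"
    using braket_commute[of v u] uv by simp
  have ne: "u \<noteq> v"
    using u uv by auto
  have "v \<noteq> 0"
    using v by (auto simp: braket_zero_right)
  \<comment> \<open>If \<open>u = k *s v\<close>, pairing with \<open>v\<close> gives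
    \<open>k = 0\<close>, hence \<open>u = 0\<close>, against \<open>braket u u = 1\<close>.\<close>
  moreover have "u \<noteq> k *s v" for k
    using u uv vu v braket_scale_right[of v k v] by (auto simp: braket_zero_right)
  ultimately have "vec.independent {u, v}"
    using ne by (auto simp: vec.independent_insert vec.span_singleton)
  then have "vec.span {u, v} = UNIV"
    using vec.card_ge_dim_independent[of "{u, v}" UNIV] ne by (auto simp: card_cart_basis card_insert_if)
  then show ?thesis
    using u v uv vu by (auto simp: orthonormal_basis_def)
qed

text \<open>The bra conjugates the entries of \<open>e\<close>, and the antisymmetry of the singlet
  swaps them and flips one sign. The resulting map is the spin flip: it is conjugate-linear,
  preserves norms and sends each vector to an orthogonal one.\<close>

lemma partial_bra_singlet:
  "partial_bra e singlet = (\<chi> i. if i = 1 then cnj (e $ 2) else - cnj (e $ 1)) /\<^sub>R sqrt 2"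
  by (simp add: vec_eq_iff forall_2 partial_bra_def singlet_def tensor_def ket0_def ket1_def axis_def
      sum_2 scaleR_conv_of_real[where 'a = complex] divide_inverse)

lemma norm_partial_bra_singlet:
  assumes "norm e = 1"
  shows "norm (partial_bra e singlet) = 1 / sqrt 2"
proof -
  have "(norm (\<chi> i :: 2. if i = 1 then cnj (e $ 2) else - cnj (e $ 1)))\<^sup>2 = (norm e)\<^sup>2"
    by (simp add: norm_power2_complex2)
  then have "norm (\<chi> i :: 2. if i = 1 then cnj (e $ 2) else - cnj (e $ 1)) = 1"
    using assms power2_eq_imp_eq[OF _ norm_ge_zero norm_ge_zero] by metis
  then show ?thesis
    by (simp add: partial_bra_singlet divide_inverse)
qed

lemma outcome_prob_singlet:
  assumes "norm e = 1"
  shows "outcome_prob singlet e = 1 / 2"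
  using assms by (simp add: outcome_prob_def norm_partial_bra_singlet power_divide)

lemma post_state_singlet:
  assumes "norm e = 1"
  shows "post_state singlet e = (\<chi> i. if i = 1 then cnj (e $ 2) else - cnj (e $ 1))"
  using assms by (simp add: post_state_def norm_partial_bra_singlet) (simp add: partial_bra_singlet)

lemma norm_post_state_singlet:
  assumes "norm e = 1"
  shows "norm (post_state singlet e) = 1"
  using assms norm_partial_bra_singlet[of e] by (simp add: post_state_def)

text \<open>A sign is a global phase. No other phase is needed below, since all the states there
  have real amplitudes.\<close>

lemma device_uminus:
  assumes "device D" "norm \<phi> = 1"
  shows "D (- \<phi>) = D \<phi>"
proof -
  have "D ((- 1) *s \<phi>) = D \<phi>"
    using assms unfolding device_def by (metis norm_minus_cancel norm_one)
  then show ?thesis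
    by (simp add: vec.scale_minus_left)
qed

lemma sets_alice_output [simp]: "sets (alice_output D \<Psi> B) = sets borel"
  using sets.sigma_sets_eq[of "borel :: real measure"] by (simp add: alice_output_def)

text \<open>Each outcome has probability 1/2, so the mixture is a plain average;
  \<open>u \<noteq> v\<close> ensures that the sum over the set \<open>{u, v}\<close> has two
  terms.\<close>

lemma measure_alice_output_singlet:
  assumes D: "device D" and A: "A \<in> sets borel"
    and uv: "u \<noteq> v" and norm: "norm u = 1" "norm v = 1"
  shows "measure (alice_output D singlet {u, v}) A =
    (measure (D (post_state singlet u)) A + measure (D (post_state singlet v)) A) / 2"
proof -
  have "prob_space (D (post_state singlet e))" if "norm e = 1" for e
    using D norm_post_state_singlet[OF that] by (auto simp: device_def)
  then have fm: "emeasure (D (post_state singlet e)) A = measure (D (post_state singlet e)) A"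
    if "norm e = 1" for e
    using that prob_space.finite_measure finite_measure.emeasure_eq_measure by blast
  have "emeasure (alice_output D singlet {u, v}) A =
      ennreal ((measure (D (post_state singlet u)) A + measure (D (post_state singlet v)) A) / 2)"
    using uv norm
    by (simp add: emeasure_alice_output[OF D A] outcome_prob_singlet fm add_divide_distrib
        del: ennreal_half flip: ennreal_mult)
  then show ?thesis
    by (simp add: measure_def)
qed

theorem mainTheorem2:
  fixes \<alpha> \<beta> :: real
    and \<phi>\<^sub>d :: "complex ^ 2"
    and \<phi>\<^sub>a :: "nat \<Rightarrow> complex ^ 2"
    and D :: "complex ^ 2 \<Rightarrow> real measure"
  assumes "\<alpha>\<^sup>2 + \<beta>\<^sup>2 = 1"
    and "distinct [1, \<alpha>\<^sup>2 - \<beta>\<^sup>2, 2 * \<alpha> * \<beta>, 0]"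
    and "\<phi>\<^sub>d = complex_of_real \<alpha> *s ket0 + complex_of_real \<beta> *s ket1"
    and "\<phi>\<^sub>a 1 = complex_of_real \<alpha> *s ket0 + complex_of_real \<beta> *s ket1"
    and "\<phi>\<^sub>a 2 = complex_of_real \<alpha> *s ket1 + complex_of_real \<beta> *s ket0"
    and "\<phi>\<^sub>a 3 = complex_of_real \<alpha> *s ket0 - complex_of_real \<beta> *s ket1"
    and "\<phi>\<^sub>a 4 = complex_of_real \<alpha> *s ket1 - complex_of_real \<beta> *s ket0"
    and "device D"
    and "\<And>i. i \<in> {1, 2, 3, 4} \<Longrightarrow>
      measure (D (\<phi>\<^sub>a i)) {x. complex_of_real x = braket (\<phi>\<^sub>a i) \<phi>\<^sub>d} = 1"
  shows "orthonormal_basis {\<phi>\<^sub>a 1, \<phi>\<^sub>a 4} \<and> orthonormal_basis {\<phi>\<^sub>a 2, \<phi>\<^sub>a 3} \<and>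
    (\<exists>S\<^sub>1 S\<^sub>2. S\<^sub>1 \<in> sets borel \<and> S\<^sub>2 \<in> sets borel \<and> S\<^sub>1 \<inter> S\<^sub>2 = {} \<and>
      measure (alice_output D singlet {\<phi>\<^sub>a 1, \<phi>\<^sub>a 4}) S\<^sub>1 = 1 \<and>
      measure (alice_output D singlet {\<phi>\<^sub>a 2, \<phi>\<^sub>a 3}) S\<^sub>2 = 1) \<and>
    \<not> no_signalling D singlet"
proof -
  \<comment> \<open>Keeps the simplifier from turning the index in \<open>\<phi>\<^sub>a 1\<close>
    into \<open>Suc 0\<close>, so that facts about it still match.\<close>
  note One_nat_def [simp del]
  note a = assms(1) and dist = assms(2) and d = assms(3) and D = assms(8)
  define q :: "real \<Rightarrow> real \<Rightarrow> complex ^ 2"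
    where "q = (\<lambda>x y. \<chi> i. if i = 1 then complex_of_real x else complex_of_real y)"
  have dq: "\<phi>\<^sub>d = q \<alpha> \<beta>" and \<phi>: "\<phi>\<^sub>a 1 = q \<alpha> \<beta>" "\<phi>\<^sub>a 2 = q \<beta> \<alpha>" "\<phi>\<^sub>a 3 = q \<alpha> (- \<beta>)" "\<phi>\<^sub>a 4 = q (- \<beta>) \<alpha>"
    unfolding d assms(4-7) by (simp_all add: q_def vec_eq_iff forall_2 ket0_def ket1_def axis_def)
  have braket_q: "braket (q x y) (q x' y') = complex_of_real (x * x' + y * y')" for x y x' y'
    by (simp add: braket_def q_def sum_2)
  have a': "\<alpha> * \<alpha> + \<beta> * \<beta> = 1" "\<beta> * \<beta> + \<alpha> * \<alpha> = 1"
    using a by (simp_all add: power2_eq_square)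
  have norm_q: "norm (q x y) = 1" if "x * x + y * y = 1" for x y
  proof -
    have "(norm (q x y))\<^sup>2 = 1"
      using that unfolding norm_power2_complex2 by (simp add: q_def power2_eq_square)
    then show ?thesis
      by (simp add: power2_eq_1_iff) (smt (verit) norm_ge_zero)
  qed
  have n: "norm (q \<alpha> \<beta>) = 1" "norm (q \<beta> \<alpha>) = 1" "norm (q \<alpha> (- \<beta>)) = 1" "norm (q (- \<beta>) \<alpha>) = 1"
    using a' by (auto intro!: norm_q)
  have post: "post_state singlet (q x y) = q y (- x)" if "norm (q x y) = 1" for x y
    unfolding post_state_singlet[OF that] by (simp add: q_def vec_eq_iff)
  have q_minus: "q (- x) (- y) = - q x y" for x y
    by (simp add: q_def vec_eq_iff)
  \<comment> \<open>The flip takes \<open>q x y\<close> to \<open>q y (- x)\<close>. It sends the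
    fourth state to the first and the second to the third exactly, but the first to minus the fourth
    and the third to minus the second; there phase invariance of \<open>D\<close> is used.\<close>
  have D_post: "D (post_state singlet (\<phi>\<^sub>a 1)) = D (\<phi>\<^sub>a 4)" "D (post_state singlet (\<phi>\<^sub>a 4)) = D (\<phi>\<^sub>a 1)"
    "D (post_state singlet (\<phi>\<^sub>a 2)) = D (\<phi>\<^sub>a 3)" "D (post_state singlet (\<phi>\<^sub>a 3)) = D (\<phi>\<^sub>a 2)"
    unfolding \<phi>
    using device_uminus[OF D n(4)] device_uminus[OF D n(2)] q_minus[of "- \<beta>" \<alpha>] q_minus[of \<beta> \<alpha>]
    by (simp_all add: post n)
  have basis: "orthonormal_basis {\<phi>\<^sub>a 1, \<phi>\<^sub>a 4}" "orthonormal_basis {\<phi>\<^sub>a 2, \<phi>\<^sub>a 3}"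
    unfolding \<phi> by (auto intro!: orthonormal_basis_pair simp: braket_q a' simp flip: of_real_mult of_real_add)
  have "braket (\<phi>\<^sub>a 1) (\<phi>\<^sub>a 4) \<noteq> braket (\<phi>\<^sub>a 1) (\<phi>\<^sub>a 1)" "braket (\<phi>\<^sub>a 2) (\<phi>\<^sub>a 3) \<noteq> braket (\<phi>\<^sub>a 2) (\<phi>\<^sub>a 2)"
    unfolding \<phi> braket_q of_real_eq_iff using a' by auto
  then have ne: "\<phi>\<^sub>a 1 \<noteq> \<phi>\<^sub>a 4" "\<phi>\<^sub>a 2 \<noteq> \<phi>\<^sub>a 3"
    by auto
  have prob: "prob_space (D (\<phi>\<^sub>a i))" "sets (D (\<phi>\<^sub>a i)) = sets borel" if "i \<in> {1, 2, 3, 4}" for i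
    using D that n by (auto simp: device_def \<phi>)
  \<comment> \<open>The certain value \<open>r\<close> carries all the mass, so by monotonicity
    every Borel set containing it has probability 1.\<close>
  have D_one: "measure (D (\<phi>\<^sub>a i)) S = 1"
    if i: "i \<in> {1, 2, 3, 4}" and S: "S \<in> sets borel" "r \<in> S" and r: "braket (\<phi>\<^sub>a i) \<phi>\<^sub>d = complex_of_real r"
    for i r S
  proof -
    interpret prob_space "D (\<phi>\<^sub>a i)"
      by (rule prob(1)[OF i])
    have "{x. complex_of_real x = braket (\<phi>\<^sub>a i) \<phi>\<^sub>d} = {r}"
      by (auto simp: r)
    with assms(9)[OF i] have "prob {r} = 1"
      by simp
    moreover have "prob {r} \<le> prob S"
      using S prob(2)[OF i] by (intro finite_measure_mono) auto
    ultimately show ?thesis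
      using prob_le_1[of S] by simp
  qed
  have out: "braket (\<phi>\<^sub>a 1) \<phi>\<^sub>d = complex_of_real 1" "braket (\<phi>\<^sub>a 2) \<phi>\<^sub>d = complex_of_real (2 * \<alpha> * \<beta>)"
    "braket (\<phi>\<^sub>a 3) \<phi>\<^sub>d = complex_of_real (\<alpha>\<^sup>2 - \<beta>\<^sup>2)" "braket (\<phi>\<^sub>a 4) \<phi>\<^sub>d = complex_of_real 0"
    unfolding dq \<phi> braket_q of_real_eq_iff using a' by (simp_all add: power2_eq_square)
  let ?M\<^sub>1 = "alice_output D singlet {\<phi>\<^sub>a 1, \<phi>\<^sub>a 4}" and ?M\<^sub>2 = "alice_output D singlet {\<phi>\<^sub>a 2, \<phi>\<^sub>a 3}"
  \<comment> \<open>\<open>S\<close> is left general because both \<open>?S\<^sub>1\<close> and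
    \<open>?S\<^sub>1 \<union> ?S\<^sub>2\<close> are used below.\<close>
  have M\<^sub>1: "measure ?M\<^sub>1 S = 1" if "S \<in> sets borel" "1 \<in> S" "0 \<in> S" for S
  proof -
    have "measure ?M\<^sub>1 S = (measure (D (\<phi>\<^sub>a 4)) S + measure (D (\<phi>\<^sub>a 1)) S) / 2"
      using measure_alice_output_singlet[OF D that(1) ne(1)] n by (simp add: D_post flip: \<phi>)
    then show ?thesis
      using D_one[OF _ that(1,2) out(1)] D_one[OF _ that(1,3) out(4)] by simp
  qed
  have M\<^sub>2: "measure ?M\<^sub>2 S = 1" if "S \<in> sets borel" "2 * \<alpha> * \<beta> \<in> S" "\<alpha>\<^sup>2 - \<beta>\<^sup>2 \<in> S" for S
  proof -
    have "measure ?M\<^sub>2 S = (measure (D (\<phi>\<^sub>a 3)) S + measure (D (\<phi>\<^sub>a 2)) S) / 2"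
      using measure_alice_output_singlet[OF D that(1) ne(2)] n by (simp add: D_post flip: \<phi>)
    then show ?thesis
      using D_one[OF _ that(1,2) out(2)] D_one[OF _ that(1,3) out(3)] by simp
  qed
  \<comment> \<open>The possible outputs for each of Bob's bases; they are disjoint because the four
    numbers are distinct.\<close>
  let ?S\<^sub>1 = "{1, 0} :: real set" and ?S\<^sub>2 = "{2 * \<alpha> * \<beta>, \<alpha>\<^sup>2 - \<beta>\<^sup>2}"
  have S: "?S\<^sub>1 \<in> sets borel" "?S\<^sub>2 \<in> sets borel"
    by simp_all
  have disj: "?S\<^sub>1 \<inter> ?S\<^sub>2 = {}"
    using dist by auto
  have one: "measure ?M\<^sub>1 ?S\<^sub>1 = 1" "measure ?M\<^sub>2 ?S\<^sub>2 = 1"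
    using M\<^sub>1[of ?S\<^sub>1] M\<^sub>2[of ?S\<^sub>2] by simp_all
  \<comment> \<open>If the two were equal, disjoint sets of measure 1 would have a union of measure
    2, yet \<open>M\<^sub>1\<close> gives that union measure 1.\<close>
  have "?M\<^sub>1 \<noteq> ?M\<^sub>2"
  proof
    assume eq: "?M\<^sub>1 = ?M\<^sub>2"
    \<comment> \<open>\<open>measure\<close> is 0 where \<open>emeasure\<close> is infinite, so the
      value 1 already implies the finiteness that \<open>measure_Union\<close> requires.\<close>
    have "emeasure ?M\<^sub>1 T \<noteq> \<infinity>" if "measure ?M\<^sub>1 T = 1" for T
      using that by (auto simp: measure_def)
    then have "measure ?M\<^sub>1 (?S\<^sub>1 \<union> ?S\<^sub>2) = measure ?M\<^sub>1 ?S\<^sub>1 + measure ?M\<^sub>1 ?S\<^sub>2"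
      using S disj one eq by (intro measure_Union) auto
    moreover have "measure ?M\<^sub>1 (?S\<^sub>1 \<union> ?S\<^sub>2) = 1"
      using S by (intro M\<^sub>1) auto
    ultimately show False
      using one eq by simp
  qed
  then have "\<not> no_signalling D singlet"
    using basis by (auto simp: no_signalling_def)
  with basis S disj one show ?thesis
    by blast
qed

end
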